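(* Let $\vartheta$ be a primitive random substitution whose RS-subshift $X_\vartheta$ is non-empty. Then $X_\vartheta$ is either finite or homeomorphic to a Cantor set.
   Context: Let $\mathcal A=\{a_1,\dots,a_n\}$ be a finite alphabet, $\mathcal A^+$ the set of non-empty finite words over $\mathcal A$, and $\mathcal A^{\mathbb Z}$ the set of bi-infinite sequences with the product topology ($\mathcal A$ discrete). A random substitution (non-degenerate; the probabilities, all non-zero, play no role here and are suppressed) is a map $\vartheta$ assigning to each letter $a_i$ a non-empty finite set $\vartheta(a_i)\subset\mathcal A^+$ of realisations. A realisation of $\vartheta(u)$, for $u=u_1\cdots u_m\in\mathcal A^+$, is a word $x_1\cdots x_m$ with each $x_j\in\vartheta(u_j)$ chosen independently for each position. Realisations of $\vartheta^k(u)$ are defined inductively: $\vartheta^0$ is the identity, and the realisations of $\vartheta^{k+1}(u)$ are the realisations of $\vartheta(v)$ for $v$ a realisation of $\vartheta^k(u)$. $\vartheta$ is primitive if there is $k\in\mathbb N$ such that for all $1\le i,j\le n$ the letter $a_i$ is a subword of some realisation of $\vartheta^k(a_j)$. A word $u\in\mathcal A^+$ is $\vartheta$-legal if it is a subword of some realisation of $\vartheta^k(a_j)$ for some $k\in\mathbb N$ and some $j$. The RS-subshift is $X_\vartheta=\{w\in\mathcal A^{\mathbb Z}: \text{every finite non-empty subword of } w \text{ is } \vartheta\text{-legal}\}$, with the subspace topology. *)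

theory Defs
  imports "HOL-Analysis.Analysis" "HOL-Library.Sublist"
begin

text \<open>
  The alphabet is a type of class \<^class>\<open>finite\<close>, words are lists over it, and subwords
  (contiguous factors) are given by \<^const>\<open>sublist\<close>. A random substitution is represented by
  its map from letters to sets of realisations; its probabilities are not recorded.
\<close>

definition random_substitution :: "('a::finite \<Rightarrow> 'a list set) \<Rightarrow> bool" where
  "random_substitution \<theta> \<longleftrightarrow> (\<forall>a. finite (\<theta> a) \<and> \<theta> a \<noteq> {} \<and> [] \<notin> \<theta> a)"

definition realisations :: "('a::finite \<Rightarrow> 'a list set) \<Rightarrow> 'a list \<Rightarrow> 'a list set" where
  "realisations \<theta> u = {concat xs | xs. list_all2 (\<lambda>x a. x \<in> \<theta> a) xs u}"

primrec realisations_pow :: "('a::finite \<Rightarrow> 'a list set) \<Rightarrow> nat \<Rightarrow> 'a list \<Rightarrow> 'a list set" where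
  "realisations_pow \<theta> 0 u = {u}"
| "realisations_pow \<theta> (Suc k) u = (\<Union>v\<in>realisations_pow \<theta> k u. realisations \<theta> v)"

definition primitive_substitution :: "('a::finite \<Rightarrow> 'a list set) \<Rightarrow> bool" where
  "primitive_substitution \<theta> \<longleftrightarrow>
     (\<exists>k. \<forall>a b. \<exists>v\<in>realisations_pow \<theta> k [b]. sublist [a] v)"

definition legal :: "('a::finite \<Rightarrow> 'a list set) \<Rightarrow> 'a list \<Rightarrow> bool" where
  "legal \<theta> u \<longleftrightarrow> u \<noteq> [] \<and> (\<exists>k b. \<exists>v\<in>realisations_pow \<theta> k [b]. sublist u v)"

definition rs_subshift :: "('a::finite \<Rightarrow> 'a list set) \<Rightarrow> (int \<Rightarrow> 'a) set" where
  "rs_subshift \<theta> = {w. \<forall>i j. i \<le> j \<longrightarrow> legal \<theta> (map w [i..j])}"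

definition full_shift_topology :: "(int \<Rightarrow> 'a::finite) topology" where
  "full_shift_topology = product_topology (\<lambda>_. discrete_topology UNIV) UNIV"

definition rs_subshift_topology :: "('a::finite \<Rightarrow> 'a list set) \<Rightarrow> (int \<Rightarrow> 'a) topology" where
  "rs_subshift_topology \<theta> = subtopology full_shift_topology (rs_subshift \<theta>)"

text \<open>
  The middle-thirds Cantor set. Removing the open middle third of every interval of stage
  \<open>n\<close> amounts to taking two copies of stage \<open>n\<close> scaled by \<open>1/3\<close>, placed in
  \<open>[0, 1/3]\<close> and \<open>[2/3, 1]\<close>.
\<close>

primrec cantor_stage :: "nat \<Rightarrow> real set" where
  "cantor_stage 0 = {0..1}"
| "cantor_stage (Suc n) =
     (\<lambda>x. x / 3) ` cantor_stage n \<union> (\<lambda>x. 2 / 3 + x / 3) ` cantor_stage n"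

definition cantor_set :: "real set" where
  "cantor_set = (\<Inter>n. cantor_stage n)"

end

theory Submission imports Defs begin

text \<open>
  By primitivity, a legal word \<open>u\<close> occurs in a realisation of \<open>\<theta>\<^sup>t(c)\<close> for every letter \<open>c\<close> and
  every large \<open>t\<close>. Substituting in long legal words therefore shows that \<open>u\<close> extends to a point of
  the subshift, and that any two legal words \<open>u\<close>, \<open>v\<close> are bridged by a legal word \<open>u B v\<close>. If a point
  \<open>w\<close> is isolated by its window \<open>u\<close>, then \<open>u B u\<close> forces \<open>w\<close> to be periodic, and \<open>u B v\<close> puts every
  legal \<open>v\<close> into \<open>w\<close>; hence the subshift is the finite orbit of \<open>w\<close>. Otherwise it is compact,
  without isolated points, and has a countable separating family of clopen sets. Such a space is
  mapped onto the Cantor set by reading a point only at the coordinates where it can still be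
  left by another point, and taking the result as ternary digits.
\<close>

subsection \<open>Ternary expansions\<close>

text \<open>The number with ternary digit 2 or 0 at place \<open>n + 1\<close> after the point
  according to \<open>b n\<close>; such numbers form the Cantor set.\<close>

definition ternary :: "(nat \<Rightarrow> bool) \<Rightarrow> real" where
  "ternary b = (\<Sum>n. (if b n then 2/3 else 0) * (1/3) ^ n)"

lemma summable_ternary: "summable (\<lambda>n. (if b n then 2/3 else 0) * (1/3::real) ^ n)"
proof (rule summable_comparison_test')
  show "summable (\<lambda>n. (2/3) * (1/3::real) ^ n)"
    by (intro summable_mult summable_geometric) auto
qed auto

text \<open>Prepending a digit is one of the two contractions that build
  \<open>cantor_stage\<close>, so the inductions below can peel off digits.\<close>

lemma ternary_rec: "ternary b = (if b 0 then 2/3 else 0) + ternary (b \<circ> Suc) / 3"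
proof -
  have "ternary b = (if b 0 then 2/3 else 0) + (\<Sum>n. (if b (Suc n) then 2/3 else 0) * (1/3) ^ Suc n)"
    unfolding ternary_def by (subst suminf_split_head[OF summable_ternary]) simp
  also have "(\<Sum>n. (if b (Suc n) then 2/3 else 0) * (1/3::real) ^ Suc n)
      = (\<Sum>n. ((if b (Suc n) then 2/3 else 0) * (1/3) ^ n) * (1/3))"
    by (intro suminf_cong) simp
  also have "\<dots> = ternary (b \<circ> Suc) / 3"
    unfolding ternary_def using suminf_mult2[OF summable_ternary, of "b \<circ> Suc" "1/3"] by simp
  finally show ?thesis .
qed

lemma ternary_bounds: "0 \<le> ternary b" "ternary b \<le> 1"
proof -
  show "0 \<le> ternary b"
    unfolding ternary_def by (intro suminf_nonneg summable_ternary) simp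
  have "ternary b \<le> (\<Sum>n. (2/3) * (1/3) ^ n)"
    unfolding ternary_def
    by (intro suminf_le summable_ternary summable_mult summable_geometric) auto
  also have "\<dots> = 1"
    by (subst suminf_mult) (auto simp: suminf_geometric summable_geometric)
  finally show "ternary b \<le> 1" .
qed

text \<open>Each common leading digit cancels and leaves a factor 1/3; the remaining tails lie in
  the unit interval.\<close>

lemma ternary_dist_le:
  assumes "\<forall>i<n. b i = b' i"
  shows "\<bar>ternary b - ternary b'\<bar> \<le> (1/3) ^ n"
  using assms
proof (induction n arbitrary: b b')
  case 0
  show ?case using ternary_bounds[of b] ternary_bounds[of b'] by auto
next
  case (Suc n)
  then have "\<bar>ternary (b \<circ> Suc) - ternary (b' \<circ> Suc)\<bar> \<le> (1/3) ^ n"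
    by (intro Suc.IH) auto
  moreover have "b 0 = b' 0" using Suc.prems by auto
  ultimately show ?case
    unfolding ternary_rec[of b] ternary_rec[of b'] by (simp add: abs_if split: if_splits)
qed

text \<open>At the first differing place the digits contribute 2/3, while the tails can take back at
  most 1/3. Omitting the digit 1 thus makes expansions unique.\<close>

lemma ternary_dist_ge:
  assumes "\<forall>i<n. b i = b' i" "b n \<noteq> b' n"
  shows "\<bar>ternary b - ternary b'\<bar> \<ge> (1/3) ^ Suc n"
  using assms
proof (induction n arbitrary: b b')
  case 0
  then show ?case
    unfolding ternary_rec[of b] ternary_rec[of b']
    using ternary_bounds[of "b \<circ> Suc"] ternary_bounds[of "b' \<circ> Suc"]
    by (auto simp: abs_if split: if_splits)
next
  case (Suc n)
  then have "\<bar>ternary (b \<circ> Suc) - ternary (b' \<circ> Suc)\<bar> \<ge> (1/3) ^ Suc n"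
    by (intro Suc.IH) auto
  moreover have "b 0 = b' 0" using Suc.prems by auto
  ultimately show ?case
    unfolding ternary_rec[of b] ternary_rec[of b'] by (simp add: abs_if split: if_splits)
qed

lemma inj_ternary: "inj ternary"
proof (rule injI, rule ccontr)
  fix b b' assume eq: "ternary b = ternary b'" and "b \<noteq> b'"
  then obtain m where "b m \<noteq> b' m" by auto
  define n where "n = (LEAST n. b n \<noteq> b' n)"
  have "b n \<noteq> b' n" unfolding n_def by (rule LeastI) fact
  moreover have "\<forall>i<n. b i = b' i" unfolding n_def using not_less_Least by blast
  ultimately have "\<bar>ternary b - ternary b'\<bar> \<ge> (1/3) ^ Suc n" by (intro ternary_dist_ge)
  moreover have "(1/3::real) ^ Suc n > 0" by simp
  ultimately show False using eq by linarith
qed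

section \<open>Ternary sums and the Cantor set\<close>

lemma ternary_in_cantor_stage: "ternary b \<in> cantor_stage n"
proof (induction n arbitrary: b)
  case 0
  show ?case using ternary_bounds[of b] by simp
next
  case (Suc n)
  have "ternary b = 2/3 + ternary (b \<circ> Suc) / 3 \<or> ternary b = ternary (b \<circ> Suc) / 3"
    using ternary_rec[of b] by auto
  then show ?case using Suc.IH[of "b \<circ> Suc"] unfolding cantor_stage.simps by blast
qed

text \<open>The copy that contains \<open>x\<close> gives the leading digit, and recursion in that
  copy gives the next ones; after \<open>n\<close> digits any tail will do.\<close>

lemma cantor_stage_near_ternary:
  assumes "x \<in> cantor_stage n"
  shows "\<exists>b. \<bar>x - ternary b\<bar> \<le> (1/3) ^ n"
  using assms
proof (induction n arbitrary: x)
  case 0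
  then show ?case using ternary_bounds[of "\<lambda>_. True"] by (intro exI[of _ "\<lambda>_. True"]) auto
next
  case (Suc n)
  then have "\<exists>d. \<exists>y\<in>cantor_stage n. x = (if d then 2/3 else 0) + y / 3"
    by (auto simp: ex_bool_eq)
  then obtain d y where y: "y \<in> cantor_stage n" "x = (if d then 2/3 else 0) + y / 3"
    by blast
  obtain b where "\<bar>y - ternary b\<bar> \<le> (1/3) ^ n" using Suc.IH[OF y(1)] by blast
  \<comment> \<open>\<open>case_nat d b\<close> is the sequence \<open>b\<close> with
    \<open>d\<close> put in front.\<close>
  moreover have "ternary (case_nat d b) = (if d then 2/3 else 0) + ternary b / 3"
    by (subst ternary_rec) (simp add: comp_def)
  ultimately have "\<bar>x - ternary (case_nat d b)\<bar> \<le> (1/3) ^ Suc n"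
    using y(2) by (simp add: abs_if split: if_splits)
  then show ?case by blast
qed

text \<open>Density suffices: the image to be compared with \<open>cantor_set\<close> will be
  compact, hence closed, so no exact expansion of \<open>x\<close> has to be built.\<close>

lemma cantor_set_subset_closure: "cantor_set \<subseteq> closure (range ternary)"
proof
  fix x assume x: "x \<in> cantor_set"
  show "x \<in> closure (range ternary)"
    unfolding closure_approachable
  proof (intro allI impI)
    fix e :: real assume "e > 0"
    then obtain n where n: "(1/3) ^ n < e" using real_arch_pow_inv[of e "1/3"] by auto
    have "x \<in> cantor_stage n" using x by (auto simp: cantor_set_def)
    then obtain b where "\<bar>x - ternary b\<bar> \<le> (1/3) ^ n" using cantor_stage_near_ternary by blast
    with n show "\<exists>y\<in>range ternary. dist y x < e"
      by (intro bexI[of _ "ternary b"]) (auto simp: dist_real_def)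
  qed
qed

subsection \<open>A characterisation of the Cantor set\<close>

text \<open>
  The coordinates \<open>c i\<close> turn \<open>S\<close> into a set of paths in the binary tree; \<open>branching S c x\<close> is the set
  of depths at which the path of \<open>x\<close> passes a node with two children in the tree of \<open>S\<close>.
\<close>

definition branching :: "'x set \<Rightarrow> (nat \<Rightarrow> 'x \<Rightarrow> bool) \<Rightarrow> 'x \<Rightarrow> nat set" where
  "branching S c x = {m. \<exists>y\<in>S. (\<forall>i<m. c i y = c i x) \<and> c m y \<noteq> c m x}"

text \<open>Since \<open>enumerate\<close> lists the branching depths in increasing order, the code
  skips the depths where \<open>S\<close> leaves no choice. This contracts the tree of
  \<open>S\<close> to a full binary tree once every point branches infinitely often.\<close>

definition branching_code :: "'x set \<Rightarrow> (nat \<Rightarrow> 'x \<Rightarrow> bool) \<Rightarrow> 'x \<Rightarrow> nat \<Rightarrow> bool" where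
  "branching_code S c x n = c (enumerate (branching S c x) n) x"

text \<open>The case \<open>k = m\<close> is included: if \<open>x\<close> and \<open>y\<close> part
  at \<open>k\<close>, each witnesses that the other branches there; if they agree, they have the
  same witnesses.\<close>

lemma branching_cong:
  assumes "x \<in> S" "y \<in> S" "\<forall>i<m. c i x = c i y" "k \<le> m"
  shows "k \<in> branching S c x \<longleftrightarrow> k \<in> branching S c y"
proof (cases "c k x = c k y")
  case True
  with assms show ?thesis unfolding branching_def by auto
next
  case False
  moreover have "\<forall>i<k. c i x = c i y" using assms(3,4) by auto
  ultimately have "k \<in> branching S c x" "k \<in> branching S c y"
    using assms(1,2) unfolding branching_def by (simp, metis)+
  then show ?thesis by blast
qed

text \<open>The index of an element in an increasing enumeration depends only on the smaller
  elements, so elements beyond \<open>m\<close> cannot interfere.\<close>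

lemma enumerate_cong_le:
  fixes A B :: "nat set"
  assumes "infinite A" "infinite B" "\<And>k. k \<le> m \<Longrightarrow> k \<in> A \<longleftrightarrow> k \<in> B" "enumerate A n \<le> m"
  shows "enumerate B n = enumerate A n"
  using assms(4)
proof (induction n)
  case 0
  show ?case
  proof (subst enumerate_0, rule Least_equality)
    show "enumerate A 0 \<in> B" using assms 0 enumerate_in_set by blast
    fix y assume "y \<in> B"
    show "enumerate A 0 \<le> y"
    proof (cases "y \<le> m")
      case True
      then have "y \<in> A" using assms(3) \<open>y \<in> B\<close> by blast
      then show ?thesis by (simp add: enumerate_0 Least_le)
    qed (use 0 in linarith)
  qed
next
  case (Suc n)
  have lt: "enumerate A n < enumerate A (Suc n)" using enumerate_step assms(1) by blast
  then have IH: "enumerate B n = enumerate A n" using Suc by linarith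
  show ?case
  proof (subst enumerate_Suc''[OF assms(2)], rule Least_equality)
    show "enumerate A (Suc n) \<in> B \<and> enumerate B n < enumerate A (Suc n)"
      using assms Suc.prems enumerate_in_set lt IH by metis
    fix y assume y: "y \<in> B \<and> enumerate B n < y"
    show "enumerate A (Suc n) \<le> y"
    proof (cases "y \<le> m")
      case True
      then have "y \<in> A" using assms(3) y by blast
      then show ?thesis using y IH by (subst enumerate_Suc''[OF assms(1)]) (auto intro: Least_le)
    qed (use Suc.prems in linarith)
  qed
qed

lemma openin_cylinder:
  fixes c :: "nat \<Rightarrow> 'x \<Rightarrow> bool"
  assumes "\<And>n. continuous_map T (discrete_topology UNIV) (c n)"
  shows "openin T {y \<in> topspace T. \<forall>i<n. c i y = c i x}"
proof (induction n)
  case (Suc n)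
  have "openin T {y \<in> topspace T. c n y \<in> {c n x}}"
    by (rule openin_continuous_map_preimage[OF assms]) simp
  with Suc have "openin T ({y \<in> topspace T. \<forall>i<n. c i y = c i x} \<inter> {y \<in> topspace T. c n y \<in> {c n x}})"
    by blast
  also have "\<dots> = {y \<in> topspace T. \<forall>i<Suc n. c i y = c i x}"
    by (auto simp: less_Suc_eq)
  finally show ?case .
qed simp

text \<open>The coordinates embed \<open>T\<close> into the binary sequences, but its tree may have
  nodes with a single child. Skipping these makes all finite patterns occur, so the image is dense
  in the Cantor set, and compactness makes it everything.\<close>

theorem homeomorphic_space_cantor_set:
  fixes T :: "'x topology" and c :: "nat \<Rightarrow> 'x \<Rightarrow> bool"
  assumes compact: "compact_space T" and nonempty: "topspace T \<noteq> {}"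
    and cont: "\<And>n. continuous_map T (discrete_topology UNIV) (c n)"
    and separating: "\<And>x y. x \<in> topspace T \<Longrightarrow> y \<in> topspace T \<Longrightarrow> (\<And>n. c n x = c n y) \<Longrightarrow> x = y"
    and perfect: "\<And>x. x \<in> topspace T \<Longrightarrow> \<not> openin T {x}"
  shows "T homeomorphic_space top_of_set cantor_set"
proof -
  define S where "S = topspace T"
  let ?br = "branching S c" and ?g = "branching_code S c"
  have cylinder: "openin T {y \<in> topspace T. \<forall>i<n. c i y = c i x}" for n x
    by (rule openin_cylinder[OF cont])
  \<comment> \<open>If \<open>x\<close> never branched from depth \<open>M\<close> on, its cylinder
    of depth \<open>M\<close> would be the open set \<open>{x}\<close>.\<close>
  have inf: "infinite (?br x)" if x: "x \<in> S" for x
  proof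
    assume "finite (?br x)"
    then obtain M where M: "\<forall>m\<in>?br x. m < M"
      unfolding finite_nat_set_iff_bounded by (rule exE)
    have "c n y = c n x" if y: "y \<in> S" "\<forall>i<M. c i y = c i x" for y n
    proof (induction n rule: less_induct)
      case (less n)
      then have "c n y \<noteq> c n x \<Longrightarrow> n \<in> ?br x" using y(1) by (auto simp: branching_def)
      then show ?case using M y(2) by blast
    qed
    then have "y = x" if "y \<in> S" "\<forall>i<M. c i y = c i x" for y
      using separating[of y x] x that unfolding S_def by blast
    then have "{y \<in> topspace T. \<forall>i<M. c i y = c i x} = {x}"
      using x unfolding S_def by blast
    then show False using cylinder[of M x] perfect[of x] x unfolding S_def by simp
  qed
  \<comment> \<open>Agreement strictly below the depth is enough, so \<open>y\<close> may leave
    \<open>x\<close> exactly there; \<open>inj\<close> and \<open>dense\<close> need this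
    case.\<close>
  have enum: "enumerate (?br y) n = enumerate (?br x) n"
    if "x \<in> S" "y \<in> S" "\<forall>i<m. c i x = c i y" "enumerate (?br x) n \<le> m" for x y m n
    using branching_cong[OF that(1-3)] that
    by (intro enumerate_cong_le[of "?br x" "?br y" m]) (simp_all add: inf)
  have code_cong: "?g y i = ?g x i"
    if "x \<in> S" "y \<in> S" "\<forall>i<enumerate (?br x) n. c i x = c i y" "i < n" for x y n i
  proof -
    have lt: "enumerate (?br x) i < enumerate (?br x) n"
      using enumerate_mono inf that by blast
    then have "enumerate (?br y) i = enumerate (?br x) i"
      using enum that by (meson less_imp_le)
    then show ?thesis using that(3) lt by (simp add: branching_code_def)
  qed
  have inj: "inj_on ?g S"
  proof (rule inj_onI, rule ccontr)
    fix x y assume xy: "x \<in> S" "y \<in> S" and eq: "?g x = ?g y" and "x \<noteq> y"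
    then obtain m' where "c m' x \<noteq> c m' y" using separating[of x y] S_def by blast
    \<comment> \<open>The first difference is a branching depth with the same index \<open>n\<close>
      for both points, so their codes differ at \<open>n\<close>.\<close>
    define m where "m = (LEAST m. c m x \<noteq> c m y)"
    have m: "c m x \<noteq> c m y" unfolding m_def by (rule LeastI) fact
    have less: "\<forall>i<m. c i x = c i y"
    proof (intro allI impI)
      fix i assume "i < m"
      then have "\<not> (c i x \<noteq> c i y)" unfolding m_def by (rule not_less_Least)
      then show "c i x = c i y" by simp
    qed
    have "\<forall>i<m. c i y = c i x" "c m y \<noteq> c m x" using m less by auto
    then have "m \<in> ?br x" using xy(2) unfolding branching_def by blast
    then obtain n where n: "enumerate (?br x) n = m"
      using enumerate_Ex[OF inf[OF xy(1)]] by blast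
    then have "enumerate (?br y) n = m" using enum[OF xy less] by simp
    then show False using fun_cong[OF eq, of n] n m by (simp add: branching_code_def)
  qed
  have dense: "\<exists>x\<in>S. \<forall>i<n. ?g x i = b i" for b n
  proof (induction n)
    case 0
    show ?case using nonempty S_def by blast
  next
    case (Suc n)
    then obtain x where x: "x \<in> S" "\<forall>i<n. ?g x i = b i" by blast
    define m where "m = enumerate (?br x) n"
    show ?case
    proof (cases "?g x n = b n")
      case True
      then show ?thesis using x less_Suc_eq by metis
    next
      case False
      have "m \<in> ?br x" unfolding m_def using enumerate_in_set inf x by blast
      \<comment> \<open>A wrong bit \<open>n\<close> is repaired by moving to a point that leaves
        \<open>x\<close> at its branching depth of index \<open>n\<close>: earlier bits survive, and
        the bit there flips.\<close>
      then obtain y where y: "y \<in> S" "\<forall>i<m. c i y = c i x" "c m y \<noteq> c m x"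
        unfolding branching_def by blast
      have agree: "\<forall>i<m. c i x = c i y" using y(2) by simp
      have "enumerate (?br y) n = m" using enum[OF x(1) y(1) agree] unfolding m_def by simp
      then have "?g y n = b n" using False y(3) unfolding branching_code_def m_def by auto
      moreover have "?g y i = b i" if "i < n" for i
        using code_cong[OF x(1) y(1) _ that] agree x(2) that unfolding m_def by auto
      ultimately show ?thesis using y(1) less_Suc_eq by metis
    qed
  qed
  define h where "h x = ternary (?g x)" for x
  have cont_h: "continuous_map T euclideanreal h"
    unfolding mtopology_is_euclidean[symmetric] Met_TC.continuous_map_to_metric
  proof (intro ballI allI impI)
    fix x and e :: real assume x: "x \<in> topspace T" and "e > 0"
    then obtain n where n: "(1/3) ^ n < e" using real_arch_pow_inv[of e "1/3"] by auto
    \<comment> \<open>Deep enough to fix the first \<open>n\<close> bits of the code.\<close>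
    let ?U = "{y \<in> topspace T. \<forall>i<enumerate (?br x) n. c i y = c i x}"
    have "h y \<in> Met_TC.mball (h x) e" if "y \<in> ?U" for y
    proof -
      have "\<forall>i<n. ?g y i = ?g x i" using code_cong[of x y n] that x S_def by auto
      then have "\<bar>h y - h x\<bar> \<le> (1/3) ^ n" unfolding h_def by (rule ternary_dist_le)
      then show ?thesis using n by (simp add: dist_real_def abs_minus_commute)
    qed
    then show "\<exists>U. openin T U \<and> x \<in> U \<and> (\<forall>y\<in>U. h y \<in> Met_TC.mball (h x) e)"
      using cylinder[of "enumerate (?br x) n" x] x by blast
  qed
  have "compact (h ` S)"
    using image_compactin[OF _ cont_h, of S] compact S_def by (simp add: compact_space_def)
  then have closed: "closed (h ` S)" by (rule compact_imp_closed)
  have "range ternary \<subseteq> closure (h ` S)"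
  proof (clarsimp simp: closure_approachable)
    fix b and e :: real assume "e > 0"
    then obtain n where n: "(1/3) ^ n < e" using real_arch_pow_inv[of e "1/3"] by auto
    obtain x where "x \<in> S" "\<forall>i<n. ?g x i = b i" using dense by blast
    then show "\<exists>x\<in>S. dist (h x) (ternary b) < e"
      using ternary_dist_le[of n "?g x" b] n by (intro bexI[of _ x]) (auto simp: h_def dist_real_def)
  qed
  \<comment> \<open>The image of \<open>h\<close>, \<open>cantor_set\<close> and the closure of
    \<open>range ternary\<close> now contain one another in a circle.\<close>
  then have "closure (range ternary) \<subseteq> h ` S" using closed by (metis closure_minimal closure_closed)
  moreover have "h ` S \<subseteq> cantor_set"
    unfolding h_def cantor_set_def using ternary_in_cantor_stage by auto
  ultimately have image: "h ` S = cantor_set" using cantor_set_subset_closure by blast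
  have "homeomorphic_map T (top_of_set cantor_set) h"
  proof (rule continuous_imp_homeomorphic_map)
    show "continuous_map T (top_of_set cantor_set) h"
      using cont_h image S_def by (auto simp: continuous_map_in_subtopology)
    show "inj_on h (topspace T)"
      using comp_inj_on[OF inj inj_on_subset[OF inj_ternary]] unfolding h_def S_def comp_def by simp
    show "h ` topspace T = topspace (top_of_set cantor_set)" using image S_def by simp
    show "Hausdorff_space (top_of_set cantor_set)" by (simp add: Hausdorff_space_subtopology)
  qed (rule compact)
  then show ?thesis by (rule homeomorphic_map_imp_homeomorphic_space)
qed

subsection \<open>Legal words\<close>

lemma realisations_append:
  assumes "v \<in> realisations \<theta> u" "v' \<in> realisations \<theta> u'"
  shows "v @ v' \<in> realisations \<theta> (u @ u')"
proof -
  obtain xs xs' where "v = concat xs" "list_all2 (\<lambda>x a. x \<in> \<theta> a) xs u"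
      "v' = concat xs'" "list_all2 (\<lambda>x a. x \<in> \<theta> a) xs' u'"
    using assms unfolding realisations_def by blast
  then show ?thesis unfolding realisations_def
    by (auto intro!: exI[of _ "xs @ xs'"] list_all2_appendI)
qed

lemma realisations_pow_append:
  assumes "v \<in> realisations_pow \<theta> k u" "v' \<in> realisations_pow \<theta> k u'"
  shows "v @ v' \<in> realisations_pow \<theta> k (u @ u')"
  using assms
proof (induction k arbitrary: v v')
  case (Suc k)
  then show ?case using realisations_append by fastforce
qed simp

lemma realisations_pow_add:
  "realisations_pow \<theta> (k + l) u = (\<Union>v\<in>realisations_pow \<theta> k u. realisations_pow \<theta> l v)"
  by (induction l) auto

lemma realisations_nonempty:
  assumes "random_substitution \<theta>"
  shows "realisations \<theta> u \<noteq> {}"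
proof (induction u)
  case Nil
  show ?case by (auto simp: realisations_def)
next
  case (Cons a u)
  obtain x where "x \<in> \<theta> a" using assms by (auto simp: random_substitution_def)
  then have "x \<in> realisations \<theta> [a]"
    unfolding realisations_def by (auto intro!: exI[of _ "[x]"])
  then show ?case using Cons realisations_append[of x \<theta> "[a]"] by fastforce
qed

lemma realisations_pow_nonempty:
  assumes "random_substitution \<theta>"
  shows "realisations_pow \<theta> k u \<noteq> {}"
  by (induction k) (use realisations_nonempty[OF assms] in auto)

text \<open>No letter is replaced by the empty word; in \<open>legal_extend\<close> this keeps long
  contexts long.\<close>

lemma realisations_length:
  assumes "random_substitution \<theta>" "v \<in> realisations \<theta> u"
  shows "length u \<le> length v"
proof -
  obtain xs where v: "v = concat xs" and xs: "list_all2 (\<lambda>x a. x \<in> \<theta> a) xs u"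
    using assms(2) unfolding realisations_def by blast
  from xs have "length u \<le> length (concat xs)"
  proof (induction rule: list_all2_induct)
    case (Cons x xs a u)
    have "x \<noteq> []" using assms(1) Cons(1) unfolding random_substitution_def by metis
    then have "length x \<ge> 1" by (cases x) auto
    then show ?case using Cons by auto
  qed simp
  then show ?thesis using v by simp
qed

lemma realisations_pow_length:
  assumes "random_substitution \<theta>" "v \<in> realisations_pow \<theta> k u"
  shows "length u \<le> length v"
  using assms(2)
proof (induction k arbitrary: v)
  case (Suc k)
  then show ?case using realisations_length[OF assms(1)] by fastforce
qed simp

text \<open>Different positions are realised independently, so the choice on \<open>u\<close> is
  completed by arbitrary choices on either side.\<close>

lemma realisations_pow_sublist:
  assumes "random_substitution \<theta>" "sublist u v" "u' \<in> realisations_pow \<theta> k u"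
  shows "\<exists>v'\<in>realisations_pow \<theta> k v. sublist u' v'"
proof -
  obtain p q where v: "v = p @ u @ q" using assms(2) by (auto simp: sublist_def)
  obtain p' q' where "p' \<in> realisations_pow \<theta> k p" "q' \<in> realisations_pow \<theta> k q"
    using realisations_pow_nonempty[OF assms(1)] by blast
  then have "p' @ u' @ q' \<in> realisations_pow \<theta> k v"
    unfolding v using assms(3) by (intro realisations_pow_append)
  then show ?thesis by blast
qed

section \<open>Legality and primitivity\<close>

lemma legal_sublist: "legal \<theta> v \<Longrightarrow> sublist u v \<Longrightarrow> u \<noteq> [] \<Longrightarrow> legal \<theta> u"
  unfolding legal_def by (meson sublist_order.order_trans)

lemma legal_realisations_pow:
  assumes "random_substitution \<theta>" "legal \<theta> u" "u' \<in> realisations_pow \<theta> k u"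
  shows "legal \<theta> u'"
proof -
  obtain m b v where v: "v \<in> realisations_pow \<theta> m [b]" "sublist u v" and "u \<noteq> []"
    using assms(2) unfolding legal_def by blast
  obtain v' where v': "v' \<in> realisations_pow \<theta> k v" "sublist u' v'"
    using realisations_pow_sublist[OF assms(1) v(2) assms(3)] by blast
  have "v' \<in> realisations_pow \<theta> (m + k) [b]"
    using v v' by (auto simp: realisations_pow_add)
  moreover have "u' \<noteq> []"
    using realisations_pow_length[OF assms(1,3)] \<open>u \<noteq> []\<close> by auto
  ultimately show ?thesis using v'(2) unfolding legal_def by blast
qed

text \<open>One bound serves all letters and all larger exponents, so that a single power can
  produce different words from different letters.\<close>

lemma legal_uniformly:
  assumes rs: "random_substitution \<theta>" and "primitive_substitution \<theta>" and "legal \<theta> u"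
  shows "\<exists>K. \<forall>t\<ge>K. \<forall>c. \<exists>v\<in>realisations_pow \<theta> t [c]. sublist u v"
proof -
  obtain k where k: "\<And>a b. \<exists>v\<in>realisations_pow \<theta> k [b]. sublist [a] v"
    using assms(2) unfolding primitive_substitution_def by blast
  obtain m b v where v: "v \<in> realisations_pow \<theta> m [b]" "sublist u v"
    using assms(3) unfolding legal_def by blast
  have "\<exists>v\<in>realisations_pow \<theta> t [c]. sublist u v" if "t \<ge> m + k" for t c
  proof -
    \<comment> \<open>The \<open>t\<close> steps split into \<open>s\<close> arbitrary ones,
      \<open>k\<close> that reach the letter \<open>b\<close> by primitivity, and \<open>m\<close>
      that produce \<open>u\<close> from \<open>b\<close>.\<close>
    define s where "s = t - (m + k)"
    have t: "t = s + k + m" using that by (simp add: s_def)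
    obtain r where r: "r \<in> realisations_pow \<theta> s [c]"
      using realisations_pow_nonempty[OF rs] by blast
    then have "r \<noteq> []" using realisations_pow_length[OF rs r] by auto
    then have "sublist [hd r] r" by (metis hd_Cons_tl append_Cons append_Nil sublist_append_rightI)
    moreover obtain w where w: "w \<in> realisations_pow \<theta> k [hd r]" "sublist [b] w" using k by blast
    ultimately obtain r' where r': "r' \<in> realisations_pow \<theta> k r" "sublist w r'"
      using realisations_pow_sublist[OF rs] by blast
    then have "sublist [b] r'" using w(2) sublist_order.order_trans by blast
    then obtain r'' where "r'' \<in> realisations_pow \<theta> m r'" "sublist v r''"
      using realisations_pow_sublist[OF rs _ v(1)] by blast
    moreover from this have "sublist u r''" using v(2) sublist_order.order_trans by blast
    ultimately show ?thesis unfolding t realisations_pow_add using r r' by blast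
  qed
  then show ?thesis by blast
qed

lemma legal_window:
  assumes "w \<in> rs_subshift \<theta>" "i \<le> j"
  shows "legal \<theta> (map w [i..j])"
  using assms unfolding rs_subshift_def by blast

text \<open>A point of the subshift supplies a legal word of two letters; a high power puts
  \<open>u\<close> into the image of the first and \<open>v\<close> into that of the second.\<close>

lemma legal_bridge:
  assumes rs: "random_substitution \<theta>" and prim: "primitive_substitution \<theta>"
    and "rs_subshift \<theta> \<noteq> {}" "legal \<theta> u" "legal \<theta> v"
  shows "\<exists>B. legal \<theta> (u @ B @ v)"
proof -
  obtain x where "x \<in> rs_subshift \<theta>" using assms(3) by blast
  then have "legal \<theta> (map x [0..1])" by (rule legal_window) simp
  then have legal: "legal \<theta> ([x 0] @ [x 1])" by (simp add: upto_rec1)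
  obtain K where K: "\<forall>t\<ge>K. \<forall>c. \<exists>r\<in>realisations_pow \<theta> t [c]. sublist u r"
    using legal_uniformly[OF rs prim assms(4)] by blast
  obtain L where L: "\<forall>t\<ge>L. \<forall>c. \<exists>r\<in>realisations_pow \<theta> t [c]. sublist v r"
    using legal_uniformly[OF rs prim assms(5)] by blast
  \<comment> \<open>Both letters must be substituted equally often for their images to be
    joined.\<close>
  define t where "t = max K L"
  have "t \<ge> K" "t \<ge> L" by (auto simp: t_def)
  obtain r where r: "r \<in> realisations_pow \<theta> t [x 0]" "sublist u r" using K \<open>t \<ge> K\<close> by blast
  obtain s where s: "s \<in> realisations_pow \<theta> t [x 1]" "sublist v s" using L \<open>t \<ge> L\<close> by blast
  have "r @ s \<in> realisations_pow \<theta> t ([x 0] @ [x 1])"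
    using r(1) s(1) by (rule realisations_pow_append)
  then have *: "legal \<theta> (r @ s)" using legal_realisations_pow[OF rs legal] by blast
  obtain p q where "r = p @ u @ q" using r(2) by (auto simp: sublist_def)
  moreover obtain p' q' where "s = p' @ v @ q'" using s(2) by (auto simp: sublist_def)
  \<comment> \<open>The bridge is what follows \<open>u\<close> in \<open>r\<close> together with
    what precedes \<open>v\<close> in \<open>s\<close>.\<close>
  ultimately have "r @ s = p @ (u @ (q @ p') @ v) @ q'" by simp
  then have "sublist (u @ (q @ p') @ v) (r @ s)" by (metis sublist_appendI)
  moreover have "u @ (q @ p') @ v \<noteq> []" using assms(4) by (auto simp: legal_def)
  ultimately show ?thesis using legal_sublist[OF *] by blast
qed

text \<open>In a window of radius \<open>n\<close> of some point, the middle letter is made to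
  produce \<open>z\<close>, while the \<open>n\<close> letters on either side do not shrink.\<close>

lemma legal_extend:
  assumes rs: "random_substitution \<theta>" and prim: "primitive_substitution \<theta>"
    and "rs_subshift \<theta> \<noteq> {}" "legal \<theta> z"
  shows "\<exists>l r. n \<le> length l \<and> n \<le> length r \<and> legal \<theta> (l @ z @ r)"
proof -
  obtain x where x: "x \<in> rs_subshift \<theta>" using assms(3) by blast
  define l r where "l = map x [- int n..-1]" and "r = map x [1..int n]"
  have "[- int n..int n] = [- int n..-1] @ [0] @ [1..int n]"
    using upto_split3[of "- int n" 0 "int n"] by simp
  then have "map x [- int n..int n] = l @ [x 0] @ r" by (simp add: l_def r_def)
  then have legal: "legal \<theta> (l @ [x 0] @ r)"
    using legal_window[OF x, of "- int n" "int n"] by simp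
  obtain K where "\<forall>t\<ge>K. \<forall>c. \<exists>r\<in>realisations_pow \<theta> t [c]. sublist z r"
    using legal_uniformly[OF rs prim assms(4)] by blast
  then obtain s where s: "s \<in> realisations_pow \<theta> K [x 0]" "sublist z s" by blast
  obtain l' r' where l': "l' \<in> realisations_pow \<theta> K l" and r': "r' \<in> realisations_pow \<theta> K r"
    using realisations_pow_nonempty[OF rs] by blast
  have "l' @ s @ r' \<in> realisations_pow \<theta> K (l @ [x 0] @ r)"
    using l' s(1) r' by (intro realisations_pow_append)
  then have *: "legal \<theta> (l' @ s @ r')" using legal_realisations_pow[OF rs legal] by blast
  obtain p q where "s = p @ z @ q" using s(2) by (auto simp: sublist_def)
  with * have "legal \<theta> ((l' @ p) @ z @ (q @ r'))" by simp
  moreover have "n \<le> length (l' @ p)" "n \<le> length (q @ r')"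
    using realisations_pow_length[OF rs l'] realisations_pow_length[OF rs r']
    by (auto simp: l_def r_def)
  ultimately show ?thesis by blast
qed

subsection \<open>The subshift\<close>

lemma topspace_full_shift [simp]: "topspace full_shift_topology = UNIV"
  by (auto simp: full_shift_topology_def)

lemma compact_full_shift: "compact_space (full_shift_topology :: (int \<Rightarrow> 'a::finite) topology)"
  by (simp add: full_shift_topology_def compact_space_product_topology compact_space_discrete_topology)

text \<open>Basic open sets restrict finitely many coordinates and, letters being discrete, shrink
  to sets that prescribe them. Closedness and isolation thus become statements on finite
  windows.\<close>

lemma openin_full_shift:
  "openin full_shift_topology U \<longleftrightarrow> (\<forall>x\<in>U. \<exists>F. finite F \<and> (\<forall>y. (\<forall>i\<in>F. y i = x i) \<longrightarrow> y \<in> U))"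
  (is "?lhs \<longleftrightarrow> ?rhs")
proof
  assume ?lhs
  show ?rhs
  proof
    fix x assume "x \<in> U"
    then obtain V where V: "finite {i. V i \<noteq> UNIV}" "x \<in> Pi\<^sub>E UNIV V" "Pi\<^sub>E UNIV V \<subseteq> U"
      using \<open>?lhs\<close> unfolding full_shift_topology_def openin_product_topology_alt by auto
    have "y \<in> U" if "\<forall>i\<in>{i. V i \<noteq> UNIV}. y i = x i" for y
    proof -
      have "y i \<in> V i" for i using V(2) that by (cases "V i = UNIV") (auto simp: PiE_iff)
      then show ?thesis using V(3) by auto
    qed
    then show "\<exists>F. finite F \<and> (\<forall>y. (\<forall>i\<in>F. y i = x i) \<longrightarrow> y \<in> U)" using V(1) by blast
  qed
next
  assume R: ?rhs
  show ?lhs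
    unfolding full_shift_topology_def openin_product_topology_alt
  proof
    fix x assume "x \<in> U"
    then obtain F where F: "finite F" "\<And>y. (\<forall>i\<in>F. y i = x i) \<Longrightarrow> y \<in> U" using R by blast
    define V where "V i = (if i \<in> F then {x i} else UNIV)" for i
    have "{i. V i \<noteq> UNIV} \<subseteq> F" by (auto simp: V_def)
    then have "finite {i. V i \<noteq> UNIV}" using F(1) finite_subset by blast
    moreover have "Pi\<^sub>E UNIV V \<subseteq> U"
    proof
      fix y assume y: "y \<in> Pi\<^sub>E UNIV V"
      have "y i = x i" if "i \<in> F" for i
        using PiE_mem[OF y, of i] that by (simp add: V_def)
      then show "y \<in> U" using F(2) by blast
    qed
    moreover have "x \<in> Pi\<^sub>E UNIV V" by (auto simp: V_def)
    ultimately show "\<exists>V. finite {i \<in> UNIV. V i \<noteq> topspace (discrete_topology UNIV)} \<and>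
        (\<forall>i\<in>UNIV. openin (discrete_topology UNIV) (V i)) \<and> x \<in> Pi\<^sub>E UNIV V \<and> Pi\<^sub>E UNIV V \<subseteq> U"
      by (intro exI[of _ V]) auto
  qed
qed

lemma map_upto_cong: "(\<And>k. i \<le> k \<Longrightarrow> k \<le> j \<Longrightarrow> x k = y k) \<Longrightarrow> map x [i..j] = map y [i..j]"
  by auto

lemma map_upto_shift: "map (\<lambda>k. y (k + s)) [i..j] = map y [i + s..j + s]"
  by (rule nth_equalityI) (auto simp: nth_upto algebra_simps)

lemma rs_subshift_shift:
  assumes "y \<in> rs_subshift \<theta>"
  shows "(\<lambda>k. y (k + s)) \<in> rs_subshift \<theta>"
  using assms unfolding rs_subshift_def by (simp add: map_upto_shift)

lemma closedin_rs_subshift: "closedin full_shift_topology (rs_subshift \<theta>)"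
  unfolding closedin_def topspace_full_shift openin_full_shift
proof (intro conjI ballI)
  fix x assume "x \<in> UNIV - rs_subshift \<theta>"
  then obtain i j where ij: "i \<le> j" "\<not> legal \<theta> (map x [i..j])"
    unfolding rs_subshift_def by blast
  have "y \<in> UNIV - rs_subshift \<theta>" if "\<forall>k\<in>{i..j}. y k = x k" for y
  proof -
    have "map y [i..j] = map x [i..j]" using that by (intro map_upto_cong) auto
    then show ?thesis using ij legal_window[of y \<theta> i j] by (metis DiffI UNIV_I)
  qed
  then show "\<exists>F. finite F \<and> (\<forall>y. (\<forall>k\<in>F. y k = x k) \<longrightarrow> y \<in> UNIV - rs_subshift \<theta>)"
    by (intro exI[of _ "{i..j}"]) auto
qed simp

text \<open>By compactness: \<open>legal_extend\<close> gives points that are legal on ever larger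
  windows around \<open>z\<close>, and nested non-empty closed sets have a common point.\<close>

lemma legal_occurs:
  assumes "random_substitution \<theta>" "primitive_substitution \<theta>" "rs_subshift \<theta> \<noteq> {}" "legal \<theta> z"
  shows "\<exists>y\<in>rs_subshift \<theta>. \<forall>k<length z. y (int k) = z ! k"
proof -
  define C where "C n = {y. (\<forall>k<length z. y (int k) = z ! k) \<and>
      (\<forall>i j. - int n \<le> i \<and> i \<le> j \<and> j \<le> int n \<longrightarrow> legal \<theta> (map y [i..j]))}" for n
  have closed: "closedin full_shift_topology (C n)" for n
    unfolding closedin_def topspace_full_shift openin_full_shift
  proof (intro conjI ballI)
    fix x assume x: "x \<in> UNIV - C n"
    let ?F = "{- int n..int n} \<union> int ` {..<length z}"
    have "y \<in> UNIV - C n" if y: "\<forall>k\<in>?F. y k = x k" for y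
    proof -
      have *: "map y [i..j] = map x [i..j]" if "- int n \<le> i" "j \<le> int n" for i j
        using y that by (intro map_upto_cong) auto
      have **: "y (int k) = x (int k)" if "k < length z" for k using y that by auto
      have "y \<in> C n \<longleftrightarrow> x \<in> C n"
        unfolding C_def mem_Collect_eq
        by (rule arg_cong2[of _ _ _ _ "(\<and>)"]) (use ** in force, use * in metis)
      then show ?thesis using x by blast
    qed
    then show "\<exists>F. finite F \<and> (\<forall>y. (\<forall>k\<in>F. y k = x k) \<longrightarrow> y \<in> UNIV - C n)"
      by (intro exI[of _ ?F]) auto
  qed simp
  have nonempty: "C n \<noteq> {}" for n
  proof -
    obtain l r where lr: "n \<le> length l" "n \<le> length r" "legal \<theta> (l @ z @ r)"
      using legal_extend[OF assms] by blast
    define W where "W = l @ z @ r"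
    \<comment> \<open>Centred so that \<open>z\<close> starts at coordinate 0. Values off the span
      of \<open>W\<close> are arbitrary, but lie outside the window of radius
      \<open>n\<close>.\<close>
    define y where "y i = W ! nat (i + int (length l))" for i
    have "length z > 0" using assms(4) by (simp add: legal_def)
    \<comment> \<open>Coordinate \<open>n\<close> has index \<open>length l + n\<close> in
      \<open>W\<close>, so strictness is needed; it comes from \<open>z\<close> being
      non-empty.\<close>
    then have len: "length W > length l + n" unfolding W_def length_append using lr(2) by linarith
    have "legal \<theta> (map y [i..j])" if ij: "- int n \<le> i" "i \<le> j" "j \<le> int n" for i j
    proof -
      have "map y [i..j] = take (nat (j - i + 1)) (drop (nat (i + int (length l))) W)"
      proof (rule nth_equalityI)
        show "length (map y [i..j]) = length (take (nat (j - i + 1)) (drop (nat (i + int (length l))) W))"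
          using ij lr(1) len by auto
        fix k assume "k < length (map y [i..j])"
        then have "k < nat (j - i + 1)" by simp
        moreover from this have "nat (i + int k + int (length l)) = nat (i + int (length l)) + k"
          using ij lr(1) by linarith
        ultimately show "map y [i..j] ! k = take (nat (j - i + 1)) (drop (nat (i + int (length l))) W) ! k"
          using ij lr(1) len by (simp add: nth_upto y_def)
      qed
      moreover have "sublist \<dots> W"
        by (meson sublist_drop sublist_order.order_trans sublist_take)
      ultimately have "sublist (map y [i..j]) W" by simp
      moreover have "map y [i..j] \<noteq> []" using ij by simp
      ultimately show ?thesis using legal_sublist[OF lr(3)] unfolding W_def by blast
    qed
    moreover have "y (int k) = z ! k" if "k < length z" for k
      using that by (simp add: y_def W_def nth_append nat_add_distrib)
    ultimately have "y \<in> C n" unfolding C_def by blast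
    then show ?thesis by blast
  qed
  have "decseq C" by (rule antimonoI) (auto simp: C_def)
  then have "(\<Inter>n. C n) \<noteq> {}"
    by (intro compact_space_imp_nest[OF compact_full_shift closed nonempty, of "\<lambda>n. n"])
  then obtain y where y: "\<And>n. y \<in> C n" by blast
  have "legal \<theta> (map y [i..j])" if "i \<le> j" for i j
  proof -
    define n where "n = nat (max \<bar>i\<bar> \<bar>j\<bar>)"
    have "- int n \<le> i" "j \<le> int n" by (auto simp: n_def)
    then show ?thesis using y[of n] that unfolding C_def by blast
  qed
  then have "y \<in> rs_subshift \<theta>" unfolding rs_subshift_def by blast
  moreover have "\<forall>k<length z. y (int k) = z ! k" using y[of 0] unfolding C_def by blast
  ultimately show ?thesis by blast
qed

text \<open>The hypothesis \<open>isolated\<close> is openness of \<open>{w}\<close> in terms of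
  coordinates. It makes every point that contains the window \<open>u\<close> a translate of
  \<open>w\<close>, which the bridges exploit.\<close>

lemma isolated_point_imp_finite:
  assumes \<theta>: "random_substitution \<theta>" "primitive_substitution \<theta>" "rs_subshift \<theta> \<noteq> {}"
    and w: "w \<in> rs_subshift \<theta>" and "finite F"
    and isolated: "\<And>y. y \<in> rs_subshift \<theta> \<Longrightarrow> (\<And>i. i \<in> F \<Longrightarrow> y i = w i) \<Longrightarrow> y = w"
  shows "finite (rs_subshift \<theta>)"
proof -
  obtain N where N: "F \<subseteq> {- int N..int N}"
  proof
    \<comment> \<open>Inserting 0 covers the case of empty \<open>F\<close>.\<close>
    show "F \<subseteq> {- int (nat (Max (insert 0 (abs ` F))))..int (nat (Max (insert 0 (abs ` F))))}"
    proof
      fix i assume "i \<in> F"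
      then have "\<bar>i\<bar> \<le> Max (insert 0 (abs ` F))" using assms(5) by (intro Max_ge) auto
      then show "i \<in> {- int (nat (Max (insert 0 (abs ` F))))..int (nat (Max (insert 0 (abs ` F))))}"
        by auto
    qed
  qed
  define u where "u = map w [- int N..int N]"
  have len_u: "length u = 2 * N + 1" by (simp add: u_def)
  have nth_u: "u ! k = w (int k - int N)" if "k < length u" for k
    using that by (simp add: u_def nth_upto)
  have legal_u: "legal \<theta> u" unfolding u_def using w by (rule legal_window) simp
  \<comment> \<open>In \<open>w\<close> the word \<open>u\<close> starts at \<open>- int N\<close>,
    so an occurrence at \<open>s - int N\<close> in \<open>y\<close> means a translation by
    \<open>s\<close>.\<close>
  have eq_w: "y (i + s) = w i" if y: "y \<in> rs_subshift \<theta>"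
    and occ: "\<And>k. k < length u \<Longrightarrow> y (int k + (s - int N)) = u ! k" for y s i
  proof -
    have "(\<lambda>i. y (i + s)) = w"
    proof (rule isolated)
      fix i assume "i \<in> F"
      then have i: "- int N \<le> i" "i \<le> int N" using N by auto
      then have "nat (i + int N) < length u" by (simp add: len_u)
      then show "y (i + s) = w i" using occ[of "nat (i + int N)"] nth_u i by simp
    qed (rule rs_subshift_shift[OF y])
    then show ?thesis by metis
  qed
  obtain B where B: "legal \<theta> (u @ B @ u)" using legal_bridge[OF \<theta> legal_u legal_u] by blast
  \<comment> \<open>The distance between the two copies of \<open>u\<close>: translating
    \<open>y\<close> by \<open>N\<close> and by \<open>N + p\<close> both give \<open>w\<close>,
    which therefore has period \<open>p\<close>.\<close>
  define p where "p = int (length u + length B)"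
  have "p > 0" by (simp add: p_def len_u)
  obtain y where y: "y \<in> rs_subshift \<theta>" "\<forall>k<length (u @ B @ u). y (int k) = (u @ B @ u) ! k"
    using legal_occurs[OF \<theta> B] by blast
  have y1: "y (i + int N) = w i" for i
  proof (rule eq_w[OF y(1)])
    fix k assume "k < length u"
    then show "y (int k + (int N - int N)) = u ! k" using y(2) by (simp add: nth_append)
  qed
  have y2: "y (i + (int N + p)) = w i" for i
  proof (rule eq_w[OF y(1)])
    fix k assume k: "k < length u"
    have "y (int (k + length u + length B)) = (u @ B @ u) ! (k + length u + length B)"
      by (rule y(2)[rule_format]) (use k in simp)
    also have "\<dots> = u ! k" by (simp add: nth_append)
    finally show "y (int k + (int N + p - int N)) = u ! k" by (simp add: p_def add.assoc)
  qed
  have per: "w (i + p) = w i" for i using y1[of "i + p"] y2[of i] by (simp add: algebra_simps)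
  have per_nat: "w (i + p * int n) = w i" for i n
  proof (induction n)
    case (Suc n)
    then show ?case using per[of "i + p * int n"] by (simp add: algebra_simps)
  qed simp
  have per_int: "w (i + p * q) = w i" for i q :: int
  proof (cases q rule: int_cases2)
    case (nonneg n)
    then show ?thesis using per_nat by simp
  next
    case (nonpos n)
    then show ?thesis using per_nat[of "i + p * q" n] by simp
  qed
  have shift_mod: "w (i + s mod p) = w (i + s)" for i s
    using per_int[of "i + s mod p" "s div p"] by (simp add: add.assoc)
  have occurs: "\<exists>s. \<forall>k<length v. w (int k + s) = v ! k" if v: "legal \<theta> v" for v
  proof -
    obtain B where B: "legal \<theta> (u @ B @ v)" using legal_bridge[OF \<theta> legal_u v] by blast
    obtain y where y: "y \<in> rs_subshift \<theta>" "\<forall>k<length (u @ B @ v). y (int k) = (u @ B @ v) ! k"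
      using legal_occurs[OF \<theta> B] by blast
    \<comment> \<open>The initial \<open>u\<close> turns \<open>y\<close> into a translate of
      \<open>w\<close>, so the \<open>v\<close> further on in \<open>y\<close> also occurs in
      \<open>w\<close>.\<close>
    have y1: "y (i + int N) = w i" for i
    proof (rule eq_w[OF y(1)])
      fix k assume "k < length u"
      then show "y (int k + (int N - int N)) = u ! k" using y(2) by (simp add: nth_append)
    qed
    have "w (int k + (int (length u + length B) - int N)) = v ! k" if "k < length v" for k
    proof -
      have "w (int k + (int (length u + length B) - int N)) = y (int (k + length u + length B))"
        using y1[of "int k + (int (length u + length B) - int N)"] by (simp add: algebra_simps)
      also have "\<dots> = (u @ B @ v) ! (k + length u + length B)"
        by (rule y(2)[rule_format]) (use that in simp)
      also have "\<dots> = v ! k" by (simp add: nth_append)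
      finally show ?thesis .
    qed
    then show ?thesis by blast
  qed
  have "rs_subshift \<theta> \<subseteq> (\<lambda>s i. w (i + s)) ` {0..<p}"
  proof
    fix x assume x: "x \<in> rs_subshift \<theta>"
    have window: "\<exists>s\<in>{0..<p}. \<forall>i\<in>{- int n..int n}. x i = w (i + s)" for n
    proof -
      obtain s where s: "\<And>k. k < length (map x [- int n..int n]) \<Longrightarrow>
          w (int k + s) = map x [- int n..int n] ! k"
        using occurs[OF legal_window[OF x, of "- int n" "int n"]] by auto
      have "x i = w (i + (s + int n) mod p)" if "i \<in> {- int n..int n}" for i
        using s[of "nat (i + int n)"] that unfolding shift_mod by (simp add: nth_upto algebra_simps)
      then show ?thesis using \<open>p > 0\<close> by (intro bexI[of _ "(s + int n) mod p"]) auto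
    qed
    \<comment> \<open>In \<open>window\<close> the shift may depend on \<open>n\<close>. If each of
      the finitely many shifts failed at some \<open>f s\<close>, a window containing all these
      coordinates would admit none.\<close>
    have "\<exists>s\<in>{0..<p}. \<forall>i. x i = w (i + s)"
    proof (rule ccontr)
      assume "\<not> ?thesis"
      then obtain f where f: "\<And>s. s \<in> {0..<p} \<Longrightarrow> x (f s) \<noteq> w (f s + s)" by metis
      define n where "n = nat (Max (abs ` f ` {0..<p}))"
      have "f s \<in> {- int n..int n}" if "s \<in> {0..<p}" for s
      proof -
        have "\<bar>f s\<bar> \<le> Max (abs ` f ` {0..<p})" using that by (intro Max_ge) auto
        then show ?thesis by (auto simp: n_def)
      qed
      then show False using window[of n] f by blast
    qed
    then show "x \<in> (\<lambda>s i. w (i + s)) ` {0..<p}" by blast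
  qed
  then show ?thesis by (rule finite_subset) simp
qed

theorem proposition17:
  fixes \<theta> :: "'a::finite \<Rightarrow> 'a list set"
  assumes "random_substitution \<theta>"
    and "primitive_substitution \<theta>"
    and "rs_subshift \<theta> \<noteq> {}"
  shows "finite (rs_subshift \<theta>) \<or>
    rs_subshift_topology \<theta> homeomorphic_space top_of_set cantor_set"
proof (rule disj_imp[THEN iffD2], rule impI)
  assume infinite: "infinite (rs_subshift \<theta>)"
  \<comment> \<open>The clopen tests whether \<open>x i = a\<close>, over all pairs of a position
    and a letter, numbered by \<open>from_nat\<close>.\<close>
  define c :: "nat \<Rightarrow> (int \<Rightarrow> 'a) \<Rightarrow> bool"
    where "c n x = (case from_nat n of (i, a) \<Rightarrow> x i = a)" for n x
  have topspace: "topspace (rs_subshift_topology \<theta>) = rs_subshift \<theta>"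
    by (simp add: rs_subshift_topology_def)
  show "rs_subshift_topology \<theta> homeomorphic_space top_of_set cantor_set"
  proof (rule homeomorphic_space_cantor_set[of _ c])
    show "compact_space (rs_subshift_topology \<theta>)"
      unfolding rs_subshift_topology_def
      by (intro compact_space_subtopology closedin_compact_space compact_full_shift
          closedin_rs_subshift)
    show "topspace (rs_subshift_topology \<theta>) \<noteq> {}" using assms(3) topspace by simp
  next
    fix n
    obtain i a where ia: "from_nat n = (i :: int, a :: 'a)" by fastforce
    have "continuous_map full_shift_topology (discrete_topology UNIV) (\<lambda>x. x i)"
      unfolding full_shift_topology_def by (rule continuous_map_product_projection) simp
    then have "continuous_map full_shift_topology (discrete_topology UNIV) ((\<lambda>b. b = a) \<circ> (\<lambda>x. x i))"
      by (rule continuous_map_compose) simp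
    moreover have "c n = (\<lambda>b. b = a) \<circ> (\<lambda>x. x i)" by (auto simp: c_def ia)
    ultimately show "continuous_map (rs_subshift_topology \<theta>) (discrete_topology UNIV) (c n)"
      unfolding rs_subshift_topology_def by (simp add: continuous_map_from_subtopology)
  next
    fix x y :: "int \<Rightarrow> 'a" assume c: "\<And>n. c n x = c n y"
    show "x = y"
    proof
      fix i
      show "x i = y i" using c[of "to_nat (i, x i)"] by (simp add: c_def)
    qed
  next
    fix w assume "w \<in> topspace (rs_subshift_topology \<theta>)"
    then have w: "w \<in> rs_subshift \<theta>" using topspace by simp
    show "\<not> openin (rs_subshift_topology \<theta>) {w}"
    proof
      assume "openin (rs_subshift_topology \<theta>) {w}"
      then obtain U where U: "openin full_shift_topology U" "{w} = U \<inter> rs_subshift \<theta>"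
        unfolding rs_subshift_topology_def openin_subtopology by blast
      then obtain F where F: "finite F" "\<And>y. (\<forall>i\<in>F. y i = w i) \<Longrightarrow> y \<in> U"
        unfolding openin_full_shift by blast
      have "finite (rs_subshift \<theta>)"
        by (rule isolated_point_imp_finite[OF assms w F(1)]) (use F(2) U(2) in blast)
      with infinite show False by blast
    qed
  qed
qed

end
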